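(* Let $(X_i)$ be a meta-Archimax sequence with Archimedean generator $\psi$, stable tail dependence functions $(\ell_n)$ and continuous univariate marginal distribution function $F$. For each $n\ge1$, set $\eta_n=\ell_n(1,\ldots,1)$ and define the rate $r:\mathbb{N}\to(0,\infty)$ by $r_n=r(n)=1/(1-\psi(1/\eta_n))$. Assume: (i) $\eta_n\to\infty$ as $n\to\infty$; (ii) the function $x\mapsto1-\psi(1/x)$ is regularly varying at $\infty$ with index $-\rho$ for some $\rho\in(0,1]$. Then, for all $u\in[0,1]$, the diagonal power distortion $D_n^r(u)=\psi\{\eta_n\psi^{-1}(u^{1/r_n})\}$ converges to $D(u)=\psi\{(-\log u)^{1/\rho}\}$ as $n\to\infty$. If also $F\in\mathrm{MDA}(H)$ for some generalized extreme value distribution function $H$ and normalizing sequences $(c_n^* )$, $c_n^*>0$, and $(d_n^* )$, i.e. $F^n(c_n^*x+d_n^* )\to H(x)$ for all $x\in\mathbb{R}$, then, with $M_n=\max(X_1,\dots,X_n)$, $(M_n-d_n)/c_n$ converges in distribution to $G=D\circ H$, where $c_n=c^*_{\lceil r_n\rceil}$ and $d_n=d^*_{\lceil r_n\rceil}$.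
   Context: An Archimedean generator is a continuous function $\psi:[0,\infty)\to[0,1]$ with $\psi(0)=1$, $\psi(t)\to0$ as $t\to\infty$, which is strictly decreasing on $[0,\inf\{x:\psi(x)=0\}]$. Its inverse $\psi^{-1}$ is defined on $(0,1]$, and $\psi^{-1}(0):=\inf\{x:\psi(x)=0\}$ (possibly $\infty$; conventions $\psi(\infty)=0$, $-\log 0=\infty$). A stable tail dependence function (stdf) of dimension $n$ is a function $\ell_n:[0,\infty)^n\to[0,\infty)$, homogeneous of order one, such that $(u_1,\dots,u_n)\mapsto\exp[-\ell_n\{-\log u_1,\dots,-\log u_n\}]$ is an ($n$-variate extreme value) copula. A sequence $(X_i)$ of identically distributed random variables (with continuous margin $F$) is a meta-Archimax sequence with generator $\psi$ and stdfs $(\ell_n)$ if for each $n\ge2$ the unique copula $C_n$ of $(X_1,\dots,X_n)$ (so $\mathbb{P}(X_1\le x_1,\dots,X_n\le x_n)=C_n(F(x_1),\dots,F(x_n))$) is $C_n(u_1,\dots,u_n)=\psi[\ell_n\{\psi^{-1}(u_1),\dots,\psi^{-1}(u_n)\}]$, $u_1,\dots,u_n\in[0,1]$. It is implicitly assumed that this is a bona fide copula for each $n$, that $\ell_1(x)=x$, and that $\ell_{n+1}(x_1,\dots,x_n,0)=\ell_n(x_1,\dots,x_n)$ for all $n\in\mathbb{N}$ and $x_i\ge0$. The generator does not depend on $n$. With $\delta_n(u)=C_n(u,\dots,u)$, the diagonal power distortion with respect to a rate $r$ is $D_n^r(u)=\delta_n(u^{1/r_n})$, $u\in[0,1]$.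 A positive measurable $f$ is regularly varying at $\infty$ with index $\alpha\in\mathbb{R}$ if $\lim_{x\to\infty}f(tx)/f(x)=t^\alpha$ for all $t>0$. Generalized extreme value (GEV) distribution functions are $H_{\xi,\mu,\sigma}$ with $\xi,\mu\in\mathbb{R}$, $\sigma>0$: $H_{\xi,\mu,\sigma}(x)=\exp(-(1+\xi(x-\mu)/\sigma)^{-1/\xi})$ if $\xi\ne0$ and $\exp(-e^{-(x-\mu)/\sigma})$ if $\xi=0$, for all $x$ with $1+\xi(x-\mu)/\sigma>0$, and the corresponding limiting value $0$ or $1$ otherwise. *)

theory Defs
  imports "HOL-Probability.Probability"
begin

text \<open>Points of \<open>[0,\<infinity>)\<^sup>n\<close> and \<open>[0,1]\<^sup>n\<close> are lists of length \<open>n\<close>, so that a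
  single statement can relate different dimensions.\<close>

definition unit_cube :: "nat \<Rightarrow> real list set" where
  "unit_cube n = {us. length us = n \<and> set us \<subseteq> {0..1}}"

definition nonneg_orthant :: "nat \<Rightarrow> real list set" where
  "nonneg_orthant n = {xs. length xs = n \<and> set xs \<subseteq> {0..}}"

text \<open>An \<open>n\<close>-variate copula is the restriction to the unit cube of a distribution function
  on \<open>\<real>\<^sup>n\<close> whose univariate margins are standard uniform.\<close>

definition copula :: "nat \<Rightarrow> (real list \<Rightarrow> real) \<Rightarrow> bool" where
  "copula n C \<longleftrightarrow>
    (\<exists>P :: (nat \<Rightarrow> real) measure.
       prob_space P \<and> sets P = sets (PiM {..<n} (\<lambda>_. borel)) \<and>
       (\<forall>i<n. distr P borel (\<lambda>x. x i) = uniform_measure lborel {0..1}) \<and>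
       (\<forall>us\<in>unit_cube n. C us = measure P {x \<in> space P. \<forall>i<n. x i \<le> us ! i}))"

text \<open>A copula is an extreme value copula if it is the limit of the copulas
  \<open>A(u\<^sub>1\<^bsup>1/m\<^esup>, \<dots>, u\<^sub>n\<^bsup>1/m\<^esup>)\<^bsup>m\<^esup>\<close> of componentwise maxima of \<open>m\<close> iid vectors with copula \<open>A\<close>.\<close>

definition extreme_value_copula :: "nat \<Rightarrow> (real list \<Rightarrow> real) \<Rightarrow> bool" where
  "extreme_value_copula n C \<longleftrightarrow> copula n C \<and>
    (\<exists>A. copula n A \<and>
       (\<forall>us\<in>unit_cube n. (\<lambda>m. A (map (\<lambda>u. u powr (1 / real m)) us) ^ m) \<longlonglongrightarrow> C us))"

text \<open>The least zero of the generator; it is \<open>\<infinity>\<close> (the infimum of the empty set) if there is none.\<close>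

definition gen_endpoint :: "(real \<Rightarrow> real) \<Rightarrow> ereal" where
  "gen_endpoint \<psi> = (INF x\<in>{x. 0 \<le> x \<and> \<psi> x = 0}. ereal x)"

text \<open>Only the values of \<open>\<psi>\<close> on \<open>[0,\<infinity>)\<close> matter.\<close>

definition archimedean_generator :: "(real \<Rightarrow> real) \<Rightarrow> bool" where
  "archimedean_generator \<psi> \<longleftrightarrow>
     continuous_on {0..} \<psi> \<and> \<psi> ` {0..} \<subseteq> {0..1} \<and> \<psi> 0 = 1 \<and> (\<psi> \<longlongrightarrow> 0) at_top \<and>
     (\<forall>x y. 0 \<le> x \<and> x < y \<and> ereal y \<le> gen_endpoint \<psi> \<longrightarrow> \<psi> y < \<psi> x)"

text \<open>The generator on \<open>[0,\<infinity>]\<close>, with \<open>\<psi>(\<infinity>) = 0\<close>.\<close>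

definition gen_ext :: "(real \<Rightarrow> real) \<Rightarrow> ereal \<Rightarrow> real" where
  "gen_ext \<psi> x = (if x = \<infinity> then 0 else \<psi> (real_of_ereal x))"

definition gen_inv :: "(real \<Rightarrow> real) \<Rightarrow> real \<Rightarrow> ereal" where
  "gen_inv \<psi> u =
     (if u = 0 then gen_endpoint \<psi>
      else ereal (the_inv_into {x. 0 \<le> x \<and> ereal x \<le> gen_endpoint \<psi>} \<psi> u))"

text \<open>\<open>-log u\<close> on \<open>[0,1]\<close>, with \<open>-log 0 = \<infinity>\<close>.\<close>

definition neg_log :: "real \<Rightarrow> ereal" where
  "neg_log u = (if u = 0 then \<infinity> else ereal (- ln u))"

text \<open>A stable tail dependence function dominates the maximum of its arguments, so it
  takes the value \<open>\<infinity>\<close> as soon as one of the arguments is \<open>\<infinity>\<close>.\<close>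

definition stdf_ext :: "(real list \<Rightarrow> real) \<Rightarrow> ereal list \<Rightarrow> ereal" where
  "stdf_ext l xs = (if \<infinity> \<in> set xs then \<infinity> else ereal (l (map real_of_ereal xs)))"

text \<open>\<open>gen_ext (\<lambda>t. exp (-t))\<close> is \<open>t \<mapsto> exp(-t)\<close> on \<open>[0,\<infinity>]\<close>.\<close>

definition stdf :: "nat \<Rightarrow> (real list \<Rightarrow> real) \<Rightarrow> bool" where
  "stdf n l \<longleftrightarrow>
     (\<forall>xs\<in>nonneg_orthant n. 0 \<le> l xs) \<and>
     (\<forall>xs\<in>nonneg_orthant n. \<forall>t>0. l (map (\<lambda>x. t * x) xs) = t * l xs) \<and>
     extreme_value_copula n (\<lambda>us. gen_ext (\<lambda>t. exp (- t)) (stdf_ext l (map neg_log us)))"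

definition archimax :: "(real \<Rightarrow> real) \<Rightarrow> (real list \<Rightarrow> real) \<Rightarrow> real list \<Rightarrow> real" where
  "archimax \<psi> l us = gen_ext \<psi> (stdf_ext l (map (gen_inv \<psi>) us))"

text \<open>The random variables are indexed from \<open>0\<close>: the first \<open>n\<close> of them are \<open>X 0, \<dots>, X (n - 1)\<close>.
  Since \<open>F\<close> is continuous, the copula of these is determined by the last condition.\<close>

definition meta_archimax ::
  "'a measure \<Rightarrow> (nat \<Rightarrow> 'a \<Rightarrow> real) \<Rightarrow> (real \<Rightarrow> real) \<Rightarrow> (real \<Rightarrow> real) \<Rightarrow>
   (nat \<Rightarrow> real list \<Rightarrow> real) \<Rightarrow> bool" where
  "meta_archimax M X F \<psi> l \<longleftrightarrow>
     prob_space M \<and>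
     (\<forall>i. X i \<in> borel_measurable M) \<and>
     (\<forall>i. cdf (distr M borel (X i)) = F) \<and>
     continuous_on UNIV F \<and>
     archimedean_generator \<psi> \<and>
     (\<forall>n\<ge>1. stdf n (l n)) \<and>
     (\<forall>x\<ge>0. l 1 [x] = x) \<and>
     (\<forall>n\<ge>1. \<forall>xs\<in>nonneg_orthant n. l (Suc n) (xs @ [0]) = l n xs) \<and>
     (\<forall>n\<ge>2. copula n (archimax \<psi> (l n)) \<and>
        (\<forall>x :: nat \<Rightarrow> real.
           measure M {\<omega> \<in> space M. \<forall>i<n. X i \<omega> \<le> x i} =
           archimax \<psi> (l n) (map (\<lambda>i. F (x i)) [0..<n])))"

definition diagonal :: "nat \<Rightarrow> (real list \<Rightarrow> real) \<Rightarrow> real \<Rightarrow> real" where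
  "diagonal n C u = C (replicate n u)"

definition diagonal_power_distortion ::
  "(nat \<Rightarrow> real list \<Rightarrow> real) \<Rightarrow> (nat \<Rightarrow> real) \<Rightarrow> nat \<Rightarrow> real \<Rightarrow> real" where
  "diagonal_power_distortion C r n u = diagonal n (C n) (u powr (1 / r n))"

text \<open>\<open>D(u) = \<psi>((-log u)\<^bsup>1/\<rho>\<^esup>)\<close>, with \<open>\<infinity>\<^bsup>1/\<rho>\<^esup> = \<infinity>\<close> for \<open>u = 0\<close>.\<close>

definition limit_distortion :: "(real \<Rightarrow> real) \<Rightarrow> real \<Rightarrow> real \<Rightarrow> real" where
  "limit_distortion \<psi> \<rho> u =
     gen_ext \<psi> (if neg_log u = \<infinity> then \<infinity> else ereal (real_of_ereal (neg_log u) powr (1 / \<rho>)))"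

text \<open>Regular variation at \<open>\<infinity>\<close> of a positive measurable function on \<open>(0,\<infinity>)\<close>.\<close>

definition regularly_varying :: "(real \<Rightarrow> real) \<Rightarrow> real \<Rightarrow> bool" where
  "regularly_varying f \<alpha> \<longleftrightarrow>
     f \<in> borel_measurable (restrict_space borel {0<..}) \<and> (\<forall>x>0. 0 < f x) \<and>
     (\<forall>t>0. ((\<lambda>x. f (t * x) / f x) \<longlongrightarrow> t powr \<alpha>) at_top)"

text \<open>Outside the range \<open>1 + \<xi>(x - \<mu>)/\<sigma> > 0\<close> the value is \<open>0\<close> below the left endpoint
  (\<open>\<xi> > 0\<close>) and \<open>1\<close> above the right endpoint (\<open>\<xi> < 0\<close>).\<close>

definition GEV :: "real \<Rightarrow> real \<Rightarrow> real \<Rightarrow> real \<Rightarrow> real" where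
  "GEV \<xi> \<mu> \<sigma> x =
     (if \<xi> = 0 then exp (- exp (- (x - \<mu>) / \<sigma>))
      else if 1 + \<xi> * (x - \<mu>) / \<sigma> > 0
        then exp (- ((1 + \<xi> * (x - \<mu>) / \<sigma>) powr (- 1 / \<xi>)))
      else if \<xi> > 0 then 0 else 1)"

definition MDA_with ::
  "(real \<Rightarrow> real) \<Rightarrow> (real \<Rightarrow> real) \<Rightarrow> (nat \<Rightarrow> real) \<Rightarrow> (nat \<Rightarrow> real) \<Rightarrow> bool" where
  "MDA_with F H c d \<longleftrightarrow>
     (\<forall>n\<ge>1. 0 < c n) \<and> (\<forall>x. (\<lambda>n. F (c n * x + d n) ^ n) \<longlonglongrightarrow> H x)"

text \<open>Convergence in distribution of random variables on \<open>M\<close> to the law with distribution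
  function \<open>G\<close>; this includes that \<open>G\<close> is a distribution function.\<close>

definition converges_in_distribution ::
  "'a measure \<Rightarrow> (nat \<Rightarrow> 'a \<Rightarrow> real) \<Rightarrow> (real \<Rightarrow> real) \<Rightarrow> bool" where
  "converges_in_distribution M Y G \<longleftrightarrow>
     (\<exists>N. real_distribution N \<and> cdf N = G \<and> weak_conv_m (\<lambda>n. distr M borel (Y n)) N)"

end

theory Submission
  imports Defs "HOL-Real_Asymp.Real_Asymp"
begin

text \<open>Homogeneity of \<open>\<ell>\<^sub>n\<close> reduces the diagonal of the Archimax copula to
  \<open>\<psi>(\<eta>\<^sub>n \<psi>\<^sup>-\<^sup>1(u))\<close>, so that convergence of the distortions \<open>D\<^sub>n\<close> amounts to
  \<open>\<eta>\<^sub>n \<psi>\<^sup>-\<^sup>1(u\<^bsup>1/r\<^sub>n\<^esup>) \<longlonglongrightarrow> (-log u)\<^bsup>1/\<rho>\<^esup>\<close>, which follows from regular variation and the strict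
  monotonicity of \<open>\<psi>\<close>. For the maxima, \<open>P(M\<^sub>n \<le> x\<^sub>n) = D\<^sub>n(F(x\<^sub>n)\<^bsup>r\<^sub>n\<^esup>)\<close>, where the argument
  tends to \<open>H(x)\<close> because \<open>r\<^sub>n\<close> is asymptotic to \<open>\<lceil>r\<^sub>n\<rceil>\<close>; since the \<open>D\<^sub>n\<close> are
  nondecreasing and their limit \<open>D\<close> is continuous, pointwise convergence on \<open>[0,1]\<close> suffices.\<close>

section \<open>Archimedean generators and their inverses\<close>

text \<open>By continuity the zero set of \<psi> is closed, so if it is nonempty the infimum is
  attained, and \<psi>(0) = 1 keeps it away from 0.\<close>

lemma gen_endpoint_cases:
  assumes "archimedean_generator \<psi>"
  obtains (infinite) "gen_endpoint \<psi> = \<infinity>"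
  | (finite) e where "gen_endpoint \<psi> = ereal e" "0 < e" "\<psi> e = 0"
proof -
  define S where "S = {x. 0 \<le> x \<and> \<psi> x = 0}"
  have cont: "continuous_on {0..} \<psi>" and psi0: "\<psi> 0 = 1"
    using assms by (auto simp: archimedean_generator_def)
  show ?thesis
  proof (cases "S = {}")
    case True
    then show ?thesis
      using infinite unfolding gen_endpoint_def S_def by (simp only: image_empty Inf_empty top_ereal_def)
  next
    case False
    have bdd: "bdd_below S" by (auto simp: S_def intro: bdd_belowI[of _ 0])
    have "closed ({0..} \<inter> \<psi> -` {0})"
      by (rule continuous_closed_preimage[OF cont]) auto
    then have "closed S" by (simp add: S_def vimage_def Int_def)
    then have Inf_S: "Inf S \<in> S"
      using closed_contains_Inf False bdd by blast
    have "gen_endpoint \<psi> = ereal (Inf S)"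
      unfolding gen_endpoint_def S_def[symmetric]
      by (intro antisym INF_lower INF_greatest Inf_S) (auto intro: cInf_lower bdd)
    moreover have "Inf S \<noteq> 0" using Inf_S psi0 by (auto simp: S_def)
    ultimately show ?thesis using finite Inf_S by (auto simp: S_def)
  qed
qed

lemma gen_endpoint_pos: "archimedean_generator \<psi> \<Longrightarrow> 0 < gen_endpoint \<psi>"
  by (cases rule: gen_endpoint_cases) auto

text \<open>The intermediate value theorem supplies a preimage of u in the strictly decreasing
  range, and injectivity there makes \<open>the_inv_into\<close> return it.\<close>

lemma gen_inv_eq:
  assumes gen: "archimedean_generator \<psi>" and u: "0 < u" "u \<le> 1"
  obtains t where "gen_inv \<psi> u = ereal t" "0 \<le> t" "ereal t \<le> gen_endpoint \<psi>" "\<psi> t = u"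
proof -
  define S where "S = {x. 0 \<le> x \<and> ereal x \<le> gen_endpoint \<psi>}"
  have cont: "continuous_on {0..} \<psi>" and psi0: "\<psi> 0 = 1" and lim: "(\<psi> \<longlongrightarrow> 0) at_top"
    and dec: "\<And>x y. 0 \<le> x \<Longrightarrow> x < y \<Longrightarrow> ereal y \<le> gen_endpoint \<psi> \<Longrightarrow> \<psi> y < \<psi> x"
    using gen by (auto simp: archimedean_generator_def)
  \<comment> \<open>A point of the strictly decreasing range where \<psi> has dropped to u or below:
    a large argument if the endpoint is infinite, otherwise the endpoint itself.\<close>
  obtain b where b: "0 \<le> b" "ereal b \<le> gen_endpoint \<psi>" "\<psi> b \<le> u"
    using gen
  proof (cases rule: gen_endpoint_cases)
    case infinite
    have "eventually (\<lambda>x. \<psi> x < u \<and> 0 \<le> x) at_top"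
      using order_tendstoD(2)[OF lim u(1)] eventually_ge_at_top by (rule eventually_conj)
    then obtain x where "\<psi> x < u" "0 \<le> x"
      using eventually_happens by fastforce
    with infinite that show ?thesis by auto
  next
    case (finite e)
    with u that[of e] show ?thesis by auto
  qed
  obtain t where t: "0 \<le> t" "t \<le> b" "\<psi> t = u"
    using IVT2'[of \<psi> b u 0] b u psi0 continuous_on_subset[OF cont] by fastforce
  have "ereal t \<le> gen_endpoint \<psi>" using t(2) b(2) by (meson ereal_less_eq(3) order_trans)
  moreover have "inj_on \<psi> S"
    by (rule linorder_inj_onI') (use dec in \<open>force simp: S_def\<close>)
  ultimately have "gen_inv \<psi> u = ereal t"
    using t u the_inv_into_f_f[of \<psi> S t] by (simp add: gen_inv_def S_def)
  with that t \<open>ereal t \<le> gen_endpoint \<psi>\<close> show ?thesis by blast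
qed

lemma gen_inv_nonneg:
  assumes "archimedean_generator \<psi>" "0 \<le> u" "u \<le> 1"
  shows "0 \<le> gen_inv \<psi> u"
proof (cases "u = 0")
  case True
  then show ?thesis using gen_endpoint_pos[OF assms(1)] by (simp add: gen_inv_def)
next
  case False
  with assms have "0 < u" by simp
  then obtain t where "gen_inv \<psi> u = ereal t" "0 \<le> t"
    using gen_inv_eq[OF assms(1) _ assms(3)] by blast
  then show ?thesis by simp
qed

section \<open>Copulas and stable tail dependence functions on the diagonal\<close>

lemma copula_orthant_measurable:
  fixes n :: nat
  assumes "sets P = sets (PiM {..<n} (\<lambda>_. borel))"
  shows "{x \<in> space P. \<forall>i<n. x i \<le> (b i :: real)} \<in> sets P"
proof -
  have "{x \<in> space P. x i \<le> b i} \<in> sets P" if "i < n" for i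
  proof -
    have [measurable]: "(\<lambda>x. x i) \<in> borel_measurable P"
      using that by (subst measurable_cong_sets[OF assms refl]) measurable
    show ?thesis by measurable
  qed
  then have "{x \<in> space P. \<forall>i\<in>{..<n}. x i \<le> b i} \<in> sets P"
    by (rule sets.sets_Collect_finite_All) simp_all
  then show ?thesis unfolding Ball_def lessThan_iff .
qed

lemma copula_mono:
  assumes "copula n C" "us \<in> unit_cube n" "vs \<in> unit_cube n" "\<And>i. i < n \<Longrightarrow> us ! i \<le> vs ! i"
  shows "C us \<le> C vs"
proof -
  obtain P where P: "prob_space P" "sets P = sets (PiM {..<n} (\<lambda>_. borel))"
    and C: "\<And>us. us \<in> unit_cube n \<Longrightarrow> C us = measure P {x \<in> space P. \<forall>i<n. x i \<le> us ! i}"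
    using assms(1) by (auto simp: copula_def)
  interpret prob_space P by fact
  show ?thesis
    unfolding C[OF assms(2)] C[OF assms(3)]
    by (rule finite_measure_mono[OF _ copula_orthant_measurable[OF P(2)]])
      (use assms(4) order_trans in blast)
qed

text \<open>The event bounding all coordinates lies inside the one bounding coordinate k, whose
  probability is read off the uniform margin.\<close>

lemma copula_le_component:
  assumes "copula n C" "us \<in> unit_cube n" "k < n"
  shows "C us \<le> us ! k"
proof -
  obtain P where P: "prob_space P" "sets P = sets (PiM {..<n} (\<lambda>_. borel))"
    and margin: "distr P borel (\<lambda>x. x k) = uniform_measure lborel {0..1}"
    and C: "C us = measure P {x \<in> space P. \<forall>i<n. x i \<le> us ! i}"
    using assms by (auto simp: copula_def)
  interpret prob_space P by fact
  have [measurable]: "(\<lambda>x. x k) \<in> borel_measurable P"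
    using assms(3) by (subst measurable_cong_sets[OF P(2) refl]) measurable
  have "length us = n" "set us \<subseteq> {0..1}" using assms(2) by (auto simp: unit_cube_def)
  then have "us ! k \<in> {0..1}" using assms(3) nth_mem by blast
  then have us_k: "0 \<le> us ! k" "us ! k \<le> 1" by auto
  have "C us \<le> measure P {x \<in> space P. x k \<le> us ! k}"
    unfolding C by (rule finite_measure_mono) (use assms(3) in auto)
  also have "\<dots> = measure (distr P borel (\<lambda>x. x k)) {..us ! k}"
    by (subst measure_distr) (auto intro!: arg_cong[where f = "measure P"])
  also have "\<dots> = measure lborel ({0..1} \<inter> {..us ! k}) / measure lborel {0..1::real}"
    unfolding margin by (rule measure_uniform_measure) auto
  also have "{0..1} \<inter> {..us ! k} = {0..us ! k}" using us_k by auto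
  finally show ?thesis using us_k by simp
qed

text \<open>At the point with all coordinates exp(-1) the extreme value copula equals
  exp(-l(1,...,1)), and a copula is at most each of its arguments. This makes every \<eta>(n) with n
  >= 1 positive.\<close>

lemma stdf_diagonal_ge_1:
  assumes "stdf n l" "1 \<le> n"
  shows "1 \<le> l (replicate n 1)"
proof -
  let ?us = "replicate n (exp (-1) :: real)"
  have cop: "copula n (\<lambda>us. gen_ext (\<lambda>t. exp (- t)) (stdf_ext l (map neg_log us)))"
    using assms(1) by (simp add: stdf_def extreme_value_copula_def)
  have us: "?us \<in> unit_cube n" by (auto simp: unit_cube_def)
  have "gen_ext (\<lambda>t. exp (- t)) (stdf_ext l (map neg_log ?us)) = exp (- l (replicate n 1))"
    by (simp add: neg_log_def stdf_ext_def gen_ext_def)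
  with copula_le_component[OF cop us, of 0] assms(2) show ?thesis by simp
qed

text \<open>Homogeneity settles positive finite t. It is stated for positive factors only, so t = 0
  is handled apart; for infinite t both sides are infinite because l(1,...,1) > 0.\<close>

lemma stdf_ext_replicate:
  assumes "stdf n l" "1 \<le> n" "0 \<le> t"
  shows "stdf_ext l (replicate n t) = ereal (l (replicate n 1)) * t"
proof -
  have pos: "0 < l (replicate n 1)" using stdf_diagonal_ge_1[OF assms(1,2)] by simp
  have hom: "l (map (\<lambda>x. s * x) xs) = s * l xs" if "xs \<in> nonneg_orthant n" "0 < s" for xs s
    using assms(1) that by (auto simp: stdf_def)
  \<comment> \<open>Scaling the zero vector by 2 does not move it, so its value equals twice
    itself.\<close>
  have zero: "l (replicate n 0) = 0"
    using hom[of "replicate n 0" 2] by (simp add: nonneg_orthant_def set_replicate_conv_if)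
  consider "t = \<infinity>" | s where "t = ereal s" "0 \<le> s" using assms(3) by (cases t) auto
  then show ?thesis
  proof cases
    case 1
    then show ?thesis using assms(2) pos by (simp add: stdf_ext_def)
  next
    case (2 s)
    show ?thesis
    proof (cases "s = 0")
      case True
      then show ?thesis using 2 zero by (simp add: stdf_ext_def zero_ereal_def)
    next
      case False
      with hom[of "replicate n 1" s] 2 show ?thesis
        by (simp add: stdf_ext_def nonneg_orthant_def mult.commute set_replicate_conv_if)
    qed
  qed
qed

lemma archimax_diagonal:
  assumes "archimedean_generator \<psi>" "stdf n l" "1 \<le> n" "0 \<le> u" "u \<le> 1"
  shows "archimax \<psi> l (replicate n u) = gen_ext \<psi> (ereal (l (replicate n 1)) * gen_inv \<psi> u)"
  using assms by (simp add: archimax_def stdf_ext_replicate gen_inv_nonneg)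

section \<open>The limiting distortion, and monotone functions at moving arguments\<close>

lemma limit_distortion_0 [simp]: "limit_distortion \<psi> \<rho> 0 = 0"
  by (simp add: limit_distortion_def neg_log_def gen_ext_def)

lemma limit_distortion_pos:
  "0 < u \<Longrightarrow> limit_distortion \<psi> \<rho> u = \<psi> ((- ln u) powr (1 / \<rho>))"
  by (simp add: limit_distortion_def neg_log_def gen_ext_def)

text \<open>On (0,1] this is a composition of continuous maps. At 0 the argument of \<psi> tends to
  infinity, so the decay of \<psi> matches the value 0 prescribed there.\<close>

lemma continuous_on_limit_distortion:
  assumes gen: "archimedean_generator \<psi>" and "0 < \<rho>"
  shows "continuous_on {0..1} (limit_distortion \<psi> \<rho>)"
proof (rule continuous_on_eq_continuous_within[THEN iffD2], rule ballI)
  fix u :: real assume u: "u \<in> {0..1}"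
  have cont: "continuous_on {0..} \<psi>" and lim: "(\<psi> \<longlongrightarrow> 0) at_top"
    using gen by (auto simp: archimedean_generator_def)
  show "continuous (at u within {0..1}) (limit_distortion \<psi> \<rho>)"
  proof (cases "u = 0")
    case True
    have "filterlim (\<lambda>u::real. (- ln u) powr (1 / \<rho>)) at_top (at_right 0)"
      using \<open>0 < \<rho>\<close> by real_asymp
    from filterlim_compose[OF lim this]
    have "((\<lambda>u. \<psi> ((- ln u) powr (1 / \<rho>))) \<longlongrightarrow> 0) (at 0 within {0..1})"
      by (rule filterlim_mono) (auto simp: at_within_Icc_at_right)
    moreover have "eventually (\<lambda>u. \<psi> ((- ln u) powr (1 / \<rho>)) = limit_distortion \<psi> \<rho> u)
      (at 0 within {0..1})"
      by (auto simp: eventually_at_filter limit_distortion_pos)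
    ultimately show ?thesis
      unfolding continuous_within True by (simp add: tendsto_cong)
  next
    case False
    with u have u0: "0 < u" "u \<le> 1" by auto
    \<comment> \<open>At u = 1 the base of the power vanishes; positivity of the exponent preserves
      continuity there.\<close>
    have "continuous_on {0<..1} (\<lambda>u::real. (- ln u) powr (1 / \<rho>))"
      by (rule continuous_on_powr')
        (use \<open>0 < \<rho>\<close> in \<open>auto intro!: continuous_on_minus continuous_on_ln continuous_on_id\<close>)
    then have "continuous_on {0<..1} (\<lambda>u. \<psi> ((- ln u) powr (1 / \<rho>)))"
      by (rule continuous_on_compose2[OF cont]) auto
    then have "continuous_on {0<..1} (limit_distortion \<psi> \<rho>)"
      by (rule continuous_on_eq) (auto simp: limit_distortion_pos)
    moreover have "at u within {0..1} = at u within {0<..1}"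
      by (rule at_within_nhd[of _ "{0<..}"]) (use u0 in auto)
    ultimately show ?thesis
      using u0 by (simp add: continuous_on_eq_continuous_within)
  qed
qed

text \<open>By monotonicity, \<open>f n (u n)\<close> is trapped between \<open>f n x\<close> and \<open>f n y\<close> for points \<open>x\<close>, \<open>y\<close>
  on either side of \<open>v\<close>.\<close>

lemma tendsto_mono_on_diagonal:
  fixes f :: "nat \<Rightarrow> real \<Rightarrow> real"
  assumes mono: "\<forall>\<^sub>F n in sequentially. mono_on {a..b} (f n)"
    and lim: "\<And>x. x \<in> {a..b} \<Longrightarrow> (\<lambda>n. f n x) \<longlonglongrightarrow> g x"
    and cont: "continuous_on {a..b} g"
    and u: "\<forall>\<^sub>F n in sequentially. u n \<in> {a..b}" "u \<longlonglongrightarrow> v" and v: "v \<in> {a..b}"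
  shows "(\<lambda>n. f n (u n)) \<longlonglongrightarrow> g v"
proof -
  have near: "\<exists>\<delta>>0. \<forall>x\<in>{a..b}. \<bar>x - v\<bar> < \<delta> \<longrightarrow> \<bar>g x - g v\<bar> < e" if "0 < e" for e
    using cont v that unfolding continuous_on_iff dist_real_def by blast
  show ?thesis
  proof (rule order_tendstoI)
    fix c assume c: "c < g v"
    obtain \<delta> where \<delta>: "0 < \<delta>" "\<forall>x\<in>{a..b}. \<bar>x - v\<bar> < \<delta> \<longrightarrow> \<bar>g x - g v\<bar> < g v - c"
      using near[of "g v - c"] c by auto
    \<comment> \<open>Clipping at a keeps x in the interval and still leaves x below u(n)
      eventually, because u(n) >= a and u(n) > v - \<delta>/2.\<close>
    define x where "x = max a (v - \<delta> / 2)"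
    have x: "x \<in> {a..b}" "\<bar>x - v\<bar> < \<delta>" using v \<delta>(1) by (auto simp: x_def)
    then have "c < g x" using \<delta>(2) by force
    then have "\<forall>\<^sub>F n in sequentially. c < f n x" using lim[OF x(1)] order_tendstoD(1) by blast
    moreover have "\<forall>\<^sub>F n in sequentially. v - \<delta> / 2 < u n"
      using u(2) \<delta>(1) by (intro order_tendstoD(1)) auto
    ultimately show "\<forall>\<^sub>F n in sequentially. c < f n (u n)"
      using mono u(1)
    proof eventually_elim
      case (elim n)
      then have "f n x \<le> f n (u n)" using x(1) by (intro mono_onD[of "{a..b}" "f n"]) (auto simp: x_def)
      with elim show ?case by linarith
    qed
  next
    fix c assume c: "g v < c"
    obtain \<delta> where \<delta>: "0 < \<delta>" "\<forall>x\<in>{a..b}. \<bar>x - v\<bar> < \<delta> \<longrightarrow> \<bar>g x - g v\<bar> < c - g v"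
      using near[of "c - g v"] c by auto
    define x where "x = min b (v + \<delta> / 2)"
    have x: "x \<in> {a..b}" "\<bar>x - v\<bar> < \<delta>" using v \<delta>(1) by (auto simp: x_def)
    then have "g x < c" using \<delta>(2) by force
    then have "\<forall>\<^sub>F n in sequentially. f n x < c" using lim[OF x(1)] order_tendstoD(2) by blast
    moreover have "\<forall>\<^sub>F n in sequentially. u n < v + \<delta> / 2"
      using u(2) \<delta>(1) by (intro order_tendstoD(2)) auto
    ultimately show "\<forall>\<^sub>F n in sequentially. f n (u n) < c"
      using mono u(1)
    proof eventually_elim
      case (elim n)
      then have "f n (u n) \<le> f n x" using x(1) by (intro mono_onD[of "{a..b}" "f n"]) (auto simp: x_def)
      with elim show ?case by linarith
    qed
  qed
qed

section \<open>Continuity and tails of the GEV distribution functions\<close>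

lemma GEV_nonneg: "0 \<le> GEV \<xi> \<mu> \<sigma> x"
  and GEV_le_1: "GEV \<xi> \<mu> \<sigma> x \<le> 1"
  by (auto simp: GEV_def)

text \<open>Location and scale enter for nonzero \<xi> only through an affine map; splitting it off
  leaves a function whose sole critical point is w = 0.\<close>

definition GEV_kernel :: "real \<Rightarrow> real \<Rightarrow> real" where
  "GEV_kernel \<xi> w = (if w > 0 then exp (- (w powr (- 1 / \<xi>))) else if \<xi> > 0 then 0 else 1)"

lemma GEV_eq_kernel: "\<xi> \<noteq> 0 \<Longrightarrow> GEV \<xi> \<mu> \<sigma> x = GEV_kernel \<xi> (1 + \<xi> * (x - \<mu>) / \<sigma>)"
  by (simp add: GEV_def GEV_kernel_def)

text \<open>Only w = 0 is delicate. As w decreases to 0, its power with exponent -1/\<xi> tends to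
  infinity if \<xi> > 0 and to 0 if \<xi> < 0, so the exponential meets the constant used for w <=
  0.\<close>

lemma isCont_GEV_kernel:
  assumes "\<xi> \<noteq> 0"
  shows "isCont (GEV_kernel \<xi>) w"
proof -
  consider "w > 0" | "w < 0" | "w = 0" by linarith
  then show ?thesis
  proof cases
    case 1
    have "\<forall>\<^sub>F x in nhds w. GEV_kernel \<xi> x = exp (- (x powr (- 1 / \<xi>)))"
      using eventually_nhds_in_open[of "{0<..}" w] 1
      by (auto simp: GEV_kernel_def elim: eventually_mono)
    then show ?thesis using 1 by (subst isCont_cong) (auto intro!: continuous_intros)
  next
    case 2
    have "\<forall>\<^sub>F x in nhds w. GEV_kernel \<xi> x = (if \<xi> > 0 then 0 else 1)"
      using eventually_nhds_in_open[of "{..<0}" w] 2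
      by (auto simp: GEV_kernel_def elim!: eventually_mono)
    then show ?thesis by (subst isCont_cong) auto
  next
    case 3
    have "((\<lambda>x::real. exp (- (x powr (- 1 / \<xi>)))) \<longlongrightarrow> (if \<xi> > 0 then 0 else 1)) (at_right 0)"
    proof (cases "\<xi> > 0")
      case True
      then have "((\<lambda>x::real. exp (- (x powr (- 1 / \<xi>)))) \<longlongrightarrow> 0) (at_right 0)" by real_asymp
      with True show ?thesis by simp
    next
      case False
      with assms have "\<xi> < 0" by simp
      then have "((\<lambda>x::real. exp (- (x powr (- 1 / \<xi>)))) \<longlongrightarrow> 1) (at_right 0)" by real_asymp
      with False show ?thesis by simp
    qed
    moreover have "\<forall>\<^sub>F x in at_right 0. exp (- (x powr (- 1 / \<xi>))) = GEV_kernel \<xi> x"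
      by (auto simp: eventually_at_filter GEV_kernel_def)
    ultimately have right: "(GEV_kernel \<xi> \<longlongrightarrow> GEV_kernel \<xi> 0) (at_right 0)"
      unfolding GEV_kernel_def[of \<xi> 0] by (simp add: tendsto_cong)
    have "\<forall>\<^sub>F x in at_left 0. GEV_kernel \<xi> 0 = GEV_kernel \<xi> x"
      by (auto simp: eventually_at_filter GEV_kernel_def)
    then have "(GEV_kernel \<xi> \<longlongrightarrow> GEV_kernel \<xi> 0) (at_left 0)"
      by (rule tendsto_eventually[OF eventually_mono]) simp
    with right show ?thesis by (simp add: 3 isCont_def filterlim_at_split)
  qed
qed

lemma isCont_GEV:
  assumes "\<sigma> \<noteq> 0"
  shows "isCont (GEV \<xi> \<mu> \<sigma>) x"
proof (cases "\<xi> = 0")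
  case True
  with assms show ?thesis unfolding GEV_def by (auto intro!: continuous_intros)
next
  case False
  then have "GEV \<xi> \<mu> \<sigma> = (\<lambda>x. GEV_kernel \<xi> (1 + \<xi> * (x - \<mu>) / \<sigma>))" by (simp add: GEV_eq_kernel fun_eq_iff)
  moreover have "isCont (\<lambda>x. 1 + \<xi> * (x - \<mu>) / \<sigma>) x" using assms by (intro continuous_intros)
  ultimately show ?thesis using isCont_o2 isCont_GEV_kernel[OF False] by metis
qed

lemma GEV_kernel_at_top:
  assumes "\<xi> \<noteq> 0"
  shows "(GEV_kernel \<xi> \<longlongrightarrow> (if \<xi> > 0 then 1 else 0)) at_top"
proof -
  have "((\<lambda>w::real. exp (- (w powr (- 1 / \<xi>)))) \<longlongrightarrow> (if \<xi> > 0 then 1 else 0)) at_top"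
  proof (cases "\<xi> > 0")
    case True
    then have "((\<lambda>x::real. exp (- (x powr (- 1 / \<xi>)))) \<longlongrightarrow> 1) at_top" by real_asymp
    with True show ?thesis by simp
  next
    case False
    with assms have "\<xi> < 0" by simp
    then have "((\<lambda>x::real. exp (- (x powr (- 1 / \<xi>)))) \<longlongrightarrow> 0) at_top" by real_asymp
    with False show ?thesis by simp
  qed
  moreover have "\<forall>\<^sub>F w in at_top. exp (- (w powr (- 1 / \<xi>))) = GEV_kernel \<xi> w"
    using eventually_gt_at_top[of 0] by eventually_elim (simp add: GEV_kernel_def)
  ultimately show ?thesis by (simp add: tendsto_cong)
qed

lemma GEV_kernel_at_bot: "(GEV_kernel \<xi> \<longlongrightarrow> (if \<xi> > 0 then 0 else 1)) at_bot"
  by (rule tendsto_eventually, rule eventually_mono[OF eventually_le_at_bot[of 0]])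
    (auto simp: GEV_kernel_def)

text \<open>For \<xi> > 0 the affine map preserves the two ends of the line; for \<xi> < 0 it
  exchanges them, and the limits of the kernel are exchanged as well.\<close>

lemma tendsto_GEV:
  assumes "0 < \<sigma>"
  shows GEV_at_bot: "(GEV \<xi> \<mu> \<sigma> \<longlongrightarrow> 0) at_bot" and GEV_at_top: "(GEV \<xi> \<mu> \<sigma> \<longlongrightarrow> 1) at_top"
proof -
  consider "\<xi> = 0" | "\<xi> > 0" | "\<xi> < 0" by linarith
  then have "(GEV \<xi> \<mu> \<sigma> \<longlongrightarrow> 0) at_bot \<and> (GEV \<xi> \<mu> \<sigma> \<longlongrightarrow> 1) at_top"
  proof cases
    case 1
    then have eq: "GEV \<xi> \<mu> \<sigma> = (\<lambda>x. exp (- exp (- (x - \<mu>) / \<sigma>)))" by (simp add: GEV_def fun_eq_iff)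
    show ?thesis unfolding eq using assms by (intro conjI) real_asymp+
  next
    case 2
    then have eq: "GEV \<xi> \<mu> \<sigma> = (\<lambda>x. GEV_kernel \<xi> (1 + \<xi> * (x - \<mu>) / \<sigma>))"
      by (simp add: GEV_eq_kernel fun_eq_iff)
    have "filterlim (\<lambda>x. 1 + \<xi> * (x - \<mu>) / \<sigma>) at_top at_top"
      "filterlim (\<lambda>x. 1 + \<xi> * (x - \<mu>) / \<sigma>) at_bot at_bot"
      using assms 2 by real_asymp+
    then show ?thesis
      unfolding eq using 2 GEV_kernel_at_top[of \<xi>] GEV_kernel_at_bot[of \<xi>]
      by (auto intro: filterlim_compose)
  next
    case 3
    then have eq: "GEV \<xi> \<mu> \<sigma> = (\<lambda>x. GEV_kernel \<xi> (1 + \<xi> * (x - \<mu>) / \<sigma>))"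
      by (simp add: GEV_eq_kernel fun_eq_iff)
    \<comment> \<open>The slope is written as -a with a > 0, which makes its sign explicit.\<close>
    define a where "a = - \<xi> / \<sigma>"
    have "0 < a" using assms 3 by (auto simp: a_def divide_neg_pos)
    then have "filterlim (\<lambda>x. 1 - a * (x - \<mu>)) at_bot at_top"
      "filterlim (\<lambda>x. 1 - a * (x - \<mu>)) at_top at_bot"
      by real_asymp+
    then have "filterlim (\<lambda>x. 1 + \<xi> * (x - \<mu>) / \<sigma>) at_bot at_top"
      "filterlim (\<lambda>x. 1 + \<xi> * (x - \<mu>) / \<sigma>) at_top at_bot"
      by (simp_all add: a_def)
    then show ?thesis
      unfolding eq using 3 GEV_kernel_at_top[of \<xi>] GEV_kernel_at_bot[of \<xi>]
      by (auto intro: filterlim_compose)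
  qed
  then show "(GEV \<xi> \<mu> \<sigma> \<longlongrightarrow> 0) at_bot" "(GEV \<xi> \<mu> \<sigma> \<longlongrightarrow> 1) at_top" by auto
qed

section \<open>Convergence of the distortions\<close>

text \<open>Lets arguments be compared through their values; strict decrease is available only up to
  the endpoint, whence the bounds on x and y.\<close>

lemma archimedean_generator_less_iff:
  assumes "archimedean_generator \<psi>"
    and "0 \<le> x" "ereal x \<le> gen_endpoint \<psi>" "0 \<le> y" "ereal y \<le> gen_endpoint \<psi>"
  shows "\<psi> x < \<psi> y \<longleftrightarrow> y < x"
proof -
  have dec: "\<psi> b < \<psi> a" if "0 \<le> a" "a < b" "ereal b \<le> gen_endpoint \<psi>" for a b
    using assms(1) that by (auto simp: archimedean_generator_def)
  show ?thesis
    using dec[of x y] dec[of y x] assms by (cases x y rule: linorder_cases) auto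
qed

text \<open>Continuity of \<psi> at 0 gives the limit, and the positivity contained in regular
  variation makes the approach one-sided. The reciprocal of this sequence is the rate.\<close>

lemma filterlim_one_minus_generator:
  fixes \<eta> :: "nat \<Rightarrow> real"
  assumes gen: "archimedean_generator \<psi>"
    and rv: "regularly_varying (\<lambda>x. 1 - \<psi> (1 / x)) \<alpha>"
    and eta: "filterlim \<eta> at_top sequentially"
  shows "filterlim (\<lambda>n. 1 - \<psi> (1 / \<eta> n)) (at_right 0) sequentially"
proof -
  have cont: "continuous_on {0..} \<psi>" and psi0: "\<psi> 0 = 1"
    using gen by (auto simp: archimedean_generator_def)
  have eta_pos: "\<forall>\<^sub>F n in sequentially. 0 < \<eta> n"
    using eta eventually_gt_at_top by (auto simp: filterlim_iff)
  have "(\<lambda>n. 1 / \<eta> n) \<longlonglongrightarrow> 0"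
    by (rule tendsto_divide_0[OF tendsto_const])
      (rule filterlim_at_top_imp_at_infinity[OF eta])
  then have "(\<lambda>n. \<psi> (1 / \<eta> n)) \<longlonglongrightarrow> \<psi> 0"
    using eta_pos by (intro continuous_on_tendsto_compose[OF cont])
      (auto elim: eventually_mono)
  then have "(\<lambda>n. 1 - \<psi> (1 / \<eta> n)) \<longlonglongrightarrow> 1 - 1"
    unfolding psi0 by (intro tendsto_diff tendsto_const)
  moreover have "\<forall>\<^sub>F n in sequentially. 0 < 1 - \<psi> (1 / \<eta> n)"
    using eta_pos by eventually_elim (use rv in \<open>simp add: regularly_varying_def\<close>)
  ultimately show ?thesis
    by (auto simp: filterlim_at elim: eventually_mono)
qed

text \<open>With \<open>q n = 1 - \<psi>(1/\<eta> n)\<close> and \<open>t n = \<psi>\<^sup>-\<^sup>1(u\<^bsup>q n\<^esup>)\<close>, regular variation gives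
  \<open>(1 - \<psi>(y/\<eta> n)) / q n \<longlonglongrightarrow> y\<^bsup>\<rho>\<^esup>\<close>, whereas \<open>(1 - \<psi>(t n)) / q n = (1 - u\<^bsup>q n\<^esup>) / q n \<longlonglongrightarrow> -log u\<close>.
  As \<open>\<psi>\<close> is strictly decreasing, comparing the two limits locates \<open>\<eta> n * t n\<close> relative to \<open>y\<close>.\<close>

lemma tendsto_rescaled_gen_inv:
  fixes \<eta> :: "nat \<Rightarrow> real"
  assumes gen: "archimedean_generator \<psi>"
    and rv: "regularly_varying (\<lambda>x. 1 - \<psi> (1 / x)) (- \<rho>)" and rho: "0 < \<rho>"
    and eta: "filterlim \<eta> at_top sequentially" and u: "0 < u" "u < 1"
  defines "t \<equiv> \<lambda>n. real_of_ereal (gen_inv \<psi> (u powr (1 - \<psi> (1 / \<eta> n))))"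
  shows "(\<lambda>n. \<eta> n * t n) \<longlonglongrightarrow> (- ln u) powr (1 / \<rho>)"
proof -
  define q where "q n = 1 - \<psi> (1 / \<eta> n)" for n
  define y0 where "y0 = (- ln u) powr (1 / \<rho>)"
  have y0: "0 < y0" "y0 powr \<rho> = - ln u"
    using u rho by (auto simp: y0_def powr_powr)
  have eta_pos: "\<forall>\<^sub>F n in sequentially. 0 < \<eta> n"
    using eta eventually_gt_at_top by (auto simp: filterlim_iff)
  have scaled: "(\<lambda>n. y / \<eta> n) \<longlonglongrightarrow> 0" for y
    by (rule tendsto_divide_0[OF tendsto_const])
      (rule filterlim_at_top_imp_at_infinity[OF eta])
  have q: "filterlim q (at_right 0) sequentially"
    unfolding q_def by (rule filterlim_one_minus_generator[OF gen rv eta])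
  then have q_pos: "\<forall>\<^sub>F n in sequentially. 0 < q n"
    by (auto simp: filterlim_at elim: eventually_mono)
  \<comment> \<open>This is minus the derivative of h \<mapsto> \<open>u powr h\<close> at
    0.\<close>
  have "((\<lambda>h. (1 - u powr h) / h) \<longlongrightarrow> - ln u) (at_right 0)"
    using u by real_asymp
  from filterlim_compose[OF this q]
  have lim_u: "(\<lambda>n. (1 - u powr q n) / q n) \<longlonglongrightarrow> - ln u" .
  have lim_y: "(\<lambda>n. (1 - \<psi> (y / \<eta> n)) / q n) \<longlonglongrightarrow> y powr \<rho>" if "0 < y" for y
  proof -
    \<comment> \<open>Regular variation with scale factor 1/y, to be evaluated along x = \<eta>(n);
      the negative index turns the limit into \<open>y powr \<rho>\<close>.\<close>
    have "((\<lambda>x. (1 - \<psi> (1 / (1 / y * x))) / (1 - \<psi> (1 / x))) \<longlongrightarrow> (1 / y) powr (- \<rho>)) at_top"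
      using rv[unfolded regularly_varying_def, THEN conjunct2, THEN conjunct2, rule_format, of "1 / y"]
        that by simp
    from filterlim_compose[OF this eta] that show ?thesis
      by (simp add: q_def powr_divide powr_minus_divide)
  qed
  have t: "\<forall>\<^sub>F n in sequentially. 0 \<le> t n \<and> ereal (t n) \<le> gen_endpoint \<psi> \<and> \<psi> (t n) = u powr q n"
    using q_pos
  proof eventually_elim
    case (elim n)
    then have "0 < u powr q n" "u powr q n \<le> 1" using u by (auto simp: powr_le1)
    from gen_inv_eq[OF gen this] show ?case unfolding t_def q_def by (metis real_of_ereal.simps(1))
  qed
  \<comment> \<open>A real threshold that works for finite and infinite endpoints alike: y/\<eta>(n)
    eventually lies below e, hence where \<psi> is strictly decreasing.\<close>
  obtain e where e: "0 < e" "ereal e \<le> gen_endpoint \<psi>"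
    using gen_endpoint_pos[OF gen] by (metis ereal_dense2 ereal_less(2) less_imp_le)
  have compare: "\<forall>\<^sub>F n in sequentially. (0 \<le> t n \<and> ereal (t n) \<le> gen_endpoint \<psi> \<and> \<psi> (t n) = u powr q n) \<and>
      0 < q n \<and> 0 < \<eta> n \<and> 0 \<le> y / \<eta> n \<and> ereal (y / \<eta> n) \<le> gen_endpoint \<psi>" if "0 < y" for y
    using t q_pos eta_pos order_tendstoD(2)[OF scaled e(1), of y]
  proof eventually_elim
    case (elim n)
    then have "ereal (y / \<eta> n) \<le> ereal e" by simp
    then have "ereal (y / \<eta> n) \<le> gen_endpoint \<psi>" using e(2) by (rule order_trans)
    moreover have "0 \<le> y / \<eta> n" using elim that by simp
    ultimately show ?case using elim by blast
  qed
  show ?thesis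
    unfolding y0_def[symmetric]
  proof (rule order_tendstoI)
    fix c assume "c < y0"
    \<comment> \<open>The bound c may be nonpositive, whereas \<open>lim_y\<close> needs a positive
      point; y is one, between c and \<open>y0\<close>.\<close>
    define y where "y = max c (y0 / 2)"
    have y: "0 < y" "y < y0" "c \<le> y" using y0(1) \<open>c < y0\<close> by (auto simp: y_def)
    have "y powr \<rho> < - ln u" using powr_less_mono2[OF rho, of y y0] y y0(2) by simp
    then have "\<forall>\<^sub>F n in sequentially. 0 < (1 - u powr q n) / q n - (1 - \<psi> (y / \<eta> n)) / q n"
      by (intro order_tendstoD(1)[OF tendsto_diff[OF lim_u lim_y]] y) simp
    with compare[OF y(1)] show "\<forall>\<^sub>F n in sequentially. c < \<eta> n * t n"
    proof eventually_elim
      case (elim n)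
      \<comment> \<open>Both quotients have the positive denominator q(n), and
        \<open>u powr q n\<close> is \<psi>(t(n)), so the sign of the difference compares the values
        of \<psi>.\<close>
      then have "\<psi> (t n) < \<psi> (y / \<eta> n)" by (simp add: divide_less_cancel)
      with elim have "y / \<eta> n < t n" using archimedean_generator_less_iff[OF gen] by blast
      with elim y(3) show ?case by (simp add: pos_divide_less_eq mult.commute)
    qed
  next
    fix y assume "y0 < y"
    then have y: "0 < y" using y0(1) by simp
    have "- ln u < y powr \<rho>" using powr_less_mono2[OF rho, of y0 y] \<open>y0 < y\<close> y0 by simp
    then have "\<forall>\<^sub>F n in sequentially. 0 < (1 - \<psi> (y / \<eta> n)) / q n - (1 - u powr q n) / q n"
      by (intro order_tendstoD(1)[OF tendsto_diff[OF lim_y lim_u]] y) simp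
    with compare[OF y] show "\<forall>\<^sub>F n in sequentially. \<eta> n * t n < y"
    proof eventually_elim
      case (elim n)
      then have "\<psi> (y / \<eta> n) < \<psi> (t n)" by (simp add: divide_less_cancel)
      with elim have "t n < y / \<eta> n" using archimedean_generator_less_iff[OF gen] by blast
      with elim show ?case by (simp add: pos_less_divide_eq mult.commute)
    qed
  qed
qed

text \<open>For 0 < u < 1 the rescaled inverse converges and \<psi> is continuous. The end u = 0
  rests on the decay of \<psi>; at u = 1 the sequence is constant.\<close>

lemma tendsto_limit_distortion:
  fixes \<eta> :: "nat \<Rightarrow> real"
  assumes gen: "archimedean_generator \<psi>"
    and rv: "regularly_varying (\<lambda>x. 1 - \<psi> (1 / x)) (- \<rho>)" and rho: "0 < \<rho>"
    and eta: "filterlim \<eta> at_top sequentially" and u: "0 \<le> u" "u \<le> 1"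
  shows "(\<lambda>n. gen_ext \<psi> (ereal (\<eta> n) * gen_inv \<psi> (u powr (1 - \<psi> (1 / \<eta> n)))))
    \<longlonglongrightarrow> limit_distortion \<psi> \<rho> u"
proof -
  have cont: "continuous_on {0..} \<psi>" and psi0: "\<psi> 0 = 1" and lim: "(\<psi> \<longlongrightarrow> 0) at_top"
    using gen by (auto simp: archimedean_generator_def)
  have eta_pos: "\<forall>\<^sub>F n in sequentially. 0 < \<eta> n"
    using eta eventually_gt_at_top by (auto simp: filterlim_iff)
  consider "u = 0" | "u = 1" | "0 < u" "u < 1" using u by linarith
  then show ?thesis
  proof cases
    case 1
    \<comment> \<open>Since \<open>0 powr x = 0\<close>, the inverse is always taken at 0 and equals
      the endpoint, which is positive; its product with \<eta>(n) is infinite or tends to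
      infinity.\<close>
    have "(\<lambda>n. gen_ext \<psi> (ereal (\<eta> n) * gen_endpoint \<psi>)) \<longlonglongrightarrow> 0"
      using gen
    proof (cases rule: gen_endpoint_cases)
      case infinite
      show ?thesis
        by (rule tendsto_eventually, rule eventually_mono[OF eta_pos])
          (simp add: infinite gen_ext_def)
    next
      case (finite e)
      have "filterlim (\<lambda>n. \<eta> n * e) at_top sequentially"
        using filterlim_tendsto_pos_mult_at_top[OF tendsto_const \<open>0 < e\<close> eta] by (simp add: mult.commute)
      from filterlim_compose[OF lim this] show ?thesis by (simp add: finite gen_ext_def)
    qed
    with 1 show ?thesis by (simp add: gen_inv_def)
  next
    case 2
    obtain t where t: "gen_inv \<psi> 1 = ereal t" "0 \<le> t" "ereal t \<le> gen_endpoint \<psi>" "\<psi> t = 1"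
      using gen_inv_eq[OF gen, of 1] by auto
    \<comment> \<open>Strict decrease leaves 0 as the only preimage of 1.\<close>
    have "t = 0"
      using archimedean_generator_less_iff[OF gen t(2,3), of 0] t(2,4) psi0 gen_endpoint_pos[OF gen]
      by (simp add: zero_ereal_def)
    with 2 t(1) psi0 show ?thesis by (simp add: gen_ext_def limit_distortion_pos)
  next
    case 3
    define t where "t n = real_of_ereal (gen_inv \<psi> (u powr (1 - \<psi> (1 / \<eta> n))))" for n
    have t: "\<forall>\<^sub>F n in sequentially. 0 \<le> t n \<and> gen_inv \<psi> (u powr (1 - \<psi> (1 / \<eta> n))) = ereal (t n)"
      using eta_pos
    proof eventually_elim
      case (elim n)
      then have "0 < 1 - \<psi> (1 / \<eta> n)" using rv by (simp add: regularly_varying_def)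
      then have "0 < u powr (1 - \<psi> (1 / \<eta> n))" "u powr (1 - \<psi> (1 / \<eta> n)) \<le> 1"
        using 3 by (auto simp: powr_le1)
      from gen_inv_eq[OF gen this] show ?case unfolding t_def by (metis real_of_ereal.simps(1))
    qed
    have "(\<lambda>n. \<eta> n * t n) \<longlonglongrightarrow> (- ln u) powr (1 / \<rho>)"
      unfolding t_def by (rule tendsto_rescaled_gen_inv[OF gen rv rho eta 3])
    moreover have "\<forall>\<^sub>F n in sequentially. \<eta> n * t n \<in> {0..}"
      using eta_pos t by eventually_elim simp
    ultimately have "(\<lambda>n. \<psi> (\<eta> n * t n)) \<longlonglongrightarrow> \<psi> ((- ln u) powr (1 / \<rho>))"
      by (intro continuous_on_tendsto_compose[OF cont]) auto
    moreover have "\<forall>\<^sub>F n in sequentially. \<psi> (\<eta> n * t n) =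
        gen_ext \<psi> (ereal (\<eta> n) * gen_inv \<psi> (u powr (1 - \<psi> (1 / \<eta> n))))"
      using t by eventually_elim (simp add: gen_ext_def)
    ultimately show ?thesis using 3 by (simp add: limit_distortion_pos tendsto_cong)
  qed
qed

section \<open>From integer powers to the rate, and distribution functions of maxima\<close>

text \<open>With k the ceiling of r, the power with exponent r is the k-th power raised to r/k, and
  r/k tends to 1 because r/(r+1) <= r/k <= 1.\<close>

lemma tendsto_power_imp_tendsto_powr_ceiling:
  fixes a :: "nat \<Rightarrow> real" and r :: "nat \<Rightarrow> real"
  assumes lim: "(\<lambda>m. a m ^ m) \<longlonglongrightarrow> h" and nonneg: "\<And>m. 0 \<le> a m"
    and r: "filterlim r at_top sequentially"
  shows "(\<lambda>n. a (nat \<lceil>r n\<rceil>) powr r n) \<longlonglongrightarrow> h"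
proof -
  define k where "k n = nat \<lceil>r n\<rceil>" for n
  have r_pos: "\<forall>\<^sub>F n in sequentially. 0 < r n"
    using r eventually_gt_at_top by (auto simp: filterlim_iff)
  have k: "filterlim k at_top sequentially"
    unfolding filterlim_at_top
  proof
    fix Z :: nat
    have "\<forall>\<^sub>F n in sequentially. real Z \<le> r n" using r by (auto simp: filterlim_at_top)
    then show "\<forall>\<^sub>F n in sequentially. Z \<le> k n"
      unfolding k_def by eventually_elim linarith
  qed
  have ratio: "(\<lambda>n. r n / real (k n)) \<longlonglongrightarrow> 1"
  proof (rule tendsto_sandwich)
    have "((\<lambda>x::real. x / (x + 1)) \<longlongrightarrow> 1) at_top" by real_asymp
    from filterlim_compose[OF this r] show "(\<lambda>n. r n / (r n + 1)) \<longlonglongrightarrow> 1" .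
    show "\<forall>\<^sub>F n in sequentially. r n / (r n + 1) \<le> r n / real (k n)"
      using r_pos
    proof eventually_elim
      case (elim n)
      then have "0 < real (k n)" "real (k n) \<le> r n + 1"
        unfolding k_def by linarith+
      with elim show ?case by (intro divide_left_mono) auto
    qed
    show "\<forall>\<^sub>F n in sequentially. r n / real (k n) \<le> 1"
      using r_pos
    proof eventually_elim
      case (elim n)
      then have "0 < real (k n)" "r n \<le> real (k n)"
        unfolding k_def by linarith+
      then show ?case by simp
    qed
  qed simp
  \<comment> \<open>The limiting exponent 1 is positive, so the case h = 0 is covered.\<close>
  have "(\<lambda>n. (a (k n) ^ k n) powr (r n / real (k n))) \<longlonglongrightarrow> h powr 1"
    by (rule tendsto_powr'[OF filterlim_compose[OF lim k] ratio]) (simp add: nonneg)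
  moreover have "h powr 1 = h"
    using LIMSEQ_le_const[OF lim, of 0] nonneg by simp
  moreover have "\<forall>\<^sub>F n in sequentially. (a (k n) ^ k n) powr (r n / real (k n)) = a (k n) powr r n"
    using r_pos
  proof eventually_elim
    case (elim n)
    then have k_pos: "0 < k n" by (simp add: k_def)
    show ?case
    \<comment> \<open>If the base is 0, both sides vanish, the left one because k(n) > 0.\<close>
    proof (cases "a (k n) = 0")
      case False
      then have "0 < a (k n)" using nonneg[of "k n"] by simp
      with k_pos show ?thesis by (simp add: powr_powr flip: powr_realpow)
    qed (use k_pos in simp)
  qed
  ultimately show ?thesis by (simp add: tendsto_cong flip: k_def)
qed

lemma cdf_normalized_Max:
  fixes X :: "nat \<Rightarrow> 'a \<Rightarrow> real"
  assumes X: "\<And>i. X i \<in> borel_measurable M" and n: "0 < n" and c: "0 < c"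
  shows "cdf (distr M borel (\<lambda>\<omega>. (Max ((\<lambda>i. X i \<omega>) ` {..<n}) - d) / c)) x =
    measure M {\<omega> \<in> space M. \<forall>i<n. X i \<omega> \<le> c * x + d}"
proof -
  have [measurable]: "(\<lambda>\<omega>. Max ((\<lambda>i. X i \<omega>) ` {..<n})) \<in> borel_measurable M"
    using X by (intro borel_measurable_Max) auto
  have "(Max ((\<lambda>i. X i \<omega>) ` {..<n}) - d) / c \<le> x \<longleftrightarrow> (\<forall>i<n. X i \<omega> \<le> c * x + d)" for \<omega>
  proof -
    have "(Max ((\<lambda>i. X i \<omega>) ` {..<n}) - d) / c \<le> x \<longleftrightarrow> Max ((\<lambda>i. X i \<omega>) ` {..<n}) \<le> c * x + d"
      using c by (auto simp: pos_divide_le_eq mult.commute)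
    also have "\<dots> \<longleftrightarrow> (\<forall>i<n. X i \<omega> \<le> c * x + d)"
      using n by (subst Max_le_iff) auto
    finally show ?thesis .
  qed
  then show ?thesis
    by (simp add: cdf_def measure_distr vimage_def Int_def conj_commute)
qed

text \<open>The limit law has to be exhibited as a measure; \<open>interval_measure G\<close> is one
  whose distribution function is G.\<close>

lemma converges_in_distributionI:
  assumes "mono G" "\<And>x. isCont G x" "(G \<longlongrightarrow> 0) at_bot" "(G \<longlongrightarrow> 1) at_top"
    and "\<And>x. (\<lambda>n. cdf (distr M borel (Y n)) x) \<longlonglongrightarrow> G x"
  shows "converges_in_distribution M Y G"
proof -
  have right: "continuous (at_right a) G" for a
    using assms(2) continuous_at_imp_continuous_at_within by blast
  have "real_distribution (interval_measure G)"
    using assms right by (intro real_distribution_interval_measure) (auto dest: monoD)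
  moreover have "cdf (interval_measure G) = G"
    using assms right by (intro cdf_interval_measure) (auto dest: monoD)
  ultimately show ?thesis
    using assms(5) unfolding converges_in_distribution_def weak_conv_m_def weak_conv_def by metis
qed

theorem theorem4p4:
  fixes M :: "'a measure" and X :: "nat \<Rightarrow> 'a \<Rightarrow> real" and F \<psi> :: "real \<Rightarrow> real"
    and l :: "nat \<Rightarrow> real list \<Rightarrow> real" and \<eta> r :: "nat \<Rightarrow> real" and \<rho> :: real
  assumes meta: "meta_archimax M X F \<psi> l"
    and eta: "\<And>n. n \<ge> 1 \<Longrightarrow> \<eta> n = l n (replicate n 1)"
    and rate: "\<And>n. n \<ge> 1 \<Longrightarrow> r n = 1 / (1 - \<psi> (1 / \<eta> n))"
    and eta_lim: "filterlim \<eta> at_top sequentially"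
    and rho: "0 < \<rho>" "\<rho> \<le> 1"
    and rv: "regularly_varying (\<lambda>x. 1 - \<psi> (1 / x)) (- \<rho>)"
  shows "(\<forall>u\<in>{0..1}.
            (\<forall>n\<ge>1. diagonal_power_distortion (\<lambda>n. archimax \<psi> (l n)) r n u =
                     gen_ext \<psi> (ereal (\<eta> n) * gen_inv \<psi> (u powr (1 / r n)))) \<and>
            (\<lambda>n. diagonal_power_distortion (\<lambda>n. archimax \<psi> (l n)) r n u)
              \<longlonglongrightarrow> limit_distortion \<psi> \<rho> u)
       \<and> (\<forall>\<xi> \<mu> \<sigma> c d. \<sigma> > 0 \<and> MDA_with F (GEV \<xi> \<mu> \<sigma>) c d \<longrightarrow>
            converges_in_distribution M
              (\<lambda>n \<omega>. (Max ((\<lambda>i. X i \<omega>) ` {..<n}) - d (nat \<lceil>r n\<rceil>)) / c (nat \<lceil>r n\<rceil>))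
              (limit_distortion \<psi> \<rho> \<circ> GEV \<xi> \<mu> \<sigma>))"
proof -
  define D where "D = diagonal_power_distortion (\<lambda>n. archimax \<psi> (l n)) r"
  define L where "L = limit_distortion \<psi> \<rho>"
  have gen: "archimedean_generator \<psi>" and prob: "prob_space M"
    and X: "\<And>i. X i \<in> borel_measurable M" and F: "cdf (distr M borel (X 0)) = F"
    and stdf: "\<And>n. n \<ge> 1 \<Longrightarrow> stdf n (l n)"
    and cop: "\<And>n. n \<ge> 2 \<Longrightarrow> copula n (archimax \<psi> (l n))"
    and joint: "\<And>n x. n \<ge> 2 \<Longrightarrow> measure M {\<omega> \<in> space M. \<forall>i<n. X i \<omega> \<le> x i} =
           archimax \<psi> (l n) (map (\<lambda>i. F (x i)) [0..<n])"
    using meta unfolding meta_archimax_def by auto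
  have psi: "continuous_on {0..} \<psi>" "\<psi> 0 = 1"
    using gen by (auto simp: archimedean_generator_def)
  interpret X0: real_distribution "distr M borel (X 0)"
    using prob_space.real_distribution_distr[OF prob] X by simp
  have F_range: "0 \<le> F x" "F x \<le> 1" and F_mono: "x \<le> y \<Longrightarrow> F x \<le> F y" for x y
    using X0.cdf_nonneg X0.cdf_bounded_prob X0.cdf_nondecreasing unfolding F by auto
  have r_pos: "0 < r n" if "n \<ge> 1" for n
  proof -
    have "0 < \<eta> n" using stdf_diagonal_ge_1[OF stdf[OF that] that] eta[OF that] by simp
    then show ?thesis using rv rate[OF that] by (simp add: regularly_varying_def)
  qed
  have unit: "0 \<le> u powr (1 / r n)" "u powr (1 / r n) \<le> 1" if "u \<in> {0..1}" "n \<ge> 1" for u n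
    using that r_pos[of n] by (auto simp: powr_le1)

  have D_eq: "D n u = gen_ext \<psi> (ereal (\<eta> n) * gen_inv \<psi> (u powr (1 / r n)))"
    if "u \<in> {0..1}" "n \<ge> 1" for u n
    unfolding D_def diagonal_power_distortion_def diagonal_def eta[OF that(2)]
    by (rule archimax_diagonal[OF gen stdf[OF that(2)] that(2) unit[OF that]])
  have D_lim: "(\<lambda>n. D n u) \<longlonglongrightarrow> L u" if "u \<in> {0..1}" for u
  \<comment> \<open>For n >= 1 the exponent 1/r(n) is 1 - \<psi>(1/\<eta>(n)), which identifies the
    two sequences.\<close>
  proof (rule Lim_transform_eventually)
    show "(\<lambda>n. gen_ext \<psi> (ereal (\<eta> n) * gen_inv \<psi> (u powr (1 - \<psi> (1 / \<eta> n))))) \<longlonglongrightarrow> L u"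
      unfolding L_def using that by (intro tendsto_limit_distortion[OF gen rv rho(1) eta_lim]) auto
    show "\<forall>\<^sub>F n in sequentially.
        gen_ext \<psi> (ereal (\<eta> n) * gen_inv \<psi> (u powr (1 - \<psi> (1 / \<eta> n)))) = D n u"
      using eventually_ge_at_top[of 1] by eventually_elim (subst D_eq, use that rate in simp_all)
  qed
  \<comment> \<open>Monotonicity comes from the copula property, which is assumed from dimension 2
    on.\<close>
  have D_mono: "mono_on {0..1} (D n)" if "n \<ge> 2" for n
  proof (rule mono_onI)
    fix u v :: real assume uv: "u \<in> {0..1}" "v \<in> {0..1}" "u \<le> v"
    then have "u powr (1 / r n) \<le> v powr (1 / r n)"
      using r_pos[of n] that by (intro powr_mono2) auto
    with that uv unit[of _ n] show "D n u \<le> D n v"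
      unfolding D_def diagonal_power_distortion_def diagonal_def
      by (intro copula_mono[OF cop]) (auto simp: unit_cube_def)
  qed
  have D_mono': "\<forall>\<^sub>F n in sequentially. mono_on {0..1} (D n)"
    using eventually_ge_at_top[of 2] by eventually_elim (rule D_mono)
  have L_mono: "L u \<le> L v" if "u \<in> {0..1}" "v \<in> {0..1}" "u \<le> v" for u v
    using D_lim[OF that(1)] D_lim[OF that(2)]
    by (rule LIMSEQ_le) (use D_mono that in \<open>blast dest: mono_onD\<close>)
  have L_cont: "continuous_on {0..1} L"
    unfolding L_def by (rule continuous_on_limit_distortion[OF gen rho(1)])
  have L_0: "L 0 = 0" and L_1: "L 1 = 1"
    using psi(2) by (simp_all add: L_def limit_distortion_pos)

  have "filterlim (\<lambda>n. 1 - \<psi> (1 / \<eta> n)) (at_right 0) sequentially"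
    by (rule filterlim_one_minus_generator[OF gen rv eta_lim])
  from filterlim_compose[OF filterlim_inverse_at_top_right this]
  have "filterlim (\<lambda>n. 1 / (1 - \<psi> (1 / \<eta> n))) at_top sequentially"
    by (simp add: inverse_eq_divide)
  moreover have "\<forall>\<^sub>F n in sequentially. 1 / (1 - \<psi> (1 / \<eta> n)) = r n"
    using eventually_ge_at_top[of 1] by eventually_elim (simp add: rate)
  ultimately have r_lim: "filterlim r at_top sequentially"
    by (simp add: filterlim_cong[OF refl refl])

  have "converges_in_distribution M
      (\<lambda>n \<omega>. (Max ((\<lambda>i. X i \<omega>) ` {..<n}) - d (nat \<lceil>r n\<rceil>)) / c (nat \<lceil>r n\<rceil>)) (L \<circ> GEV \<xi> \<mu> \<sigma>)"
    if sigma: "\<sigma> > 0" and mda: "MDA_with F (GEV \<xi> \<mu> \<sigma>) c d" for \<xi> \<mu> \<sigma> c d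
  proof (rule converges_in_distributionI)
    define H where "H = GEV \<xi> \<mu> \<sigma>"
    have c: "\<And>n. n \<ge> 1 \<Longrightarrow> 0 < c n" and H_lim: "\<And>x. (\<lambda>n. F (c n * x + d n) ^ n) \<longlonglongrightarrow> H x"
      using mda by (auto simp: MDA_with_def H_def)
    have H_range: "H x \<in> {0..1}" for x by (simp add: H_def GEV_nonneg GEV_le_1)
    \<comment> \<open>Monotonicity is inherited from the powers of F, the scalings being positive,
      instead of being derived from the GEV formula.\<close>
    have H_mono: "H x \<le> H y" if "x \<le> y" for x y
      using H_lim[of x] H_lim[of y]
    proof (rule LIMSEQ_le)
      have "F (c n * x + d n) ^ n \<le> F (c n * y + d n) ^ n" if "n \<ge> 1" for n
        using \<open>x \<le> y\<close> c[OF that] by (intro power_mono F_mono F_range) auto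
      then show "\<exists>N. \<forall>n\<ge>N. F (c n * x + d n) ^ n \<le> F (c n * y + d n) ^ n" by blast
    qed
    \<comment> \<open>The filter is left general to serve both for continuity at a point and for the
      limits at the two ends of the line.\<close>
    have L_H: "((\<lambda>x. L (H x)) \<longlongrightarrow> L h) A" if "(H \<longlongrightarrow> h) A" "h \<in> {0..1}" for h A
      by (rule continuous_on_tendsto_compose[OF L_cont that]) (use H_range in simp)
    show "mono (L \<circ> GEV \<xi> \<mu> \<sigma>)"
      using H_mono H_range L_mono unfolding H_def by (auto intro!: monoI)
    show "isCont (L \<circ> GEV \<xi> \<mu> \<sigma>) x" for x
      using L_H[of "H x"] H_range isCont_GEV[of \<sigma>] sigma unfolding H_def by (simp add: isCont_def o_def)
    show "((L \<circ> GEV \<xi> \<mu> \<sigma>) \<longlongrightarrow> 0) at_bot" "((L \<circ> GEV \<xi> \<mu> \<sigma>) \<longlongrightarrow> 1) at_top"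
      using L_H[of 0] L_H[of 1] tendsto_GEV[OF sigma] L_0 L_1 unfolding H_def by (simp_all add: o_def)
    fix x
    \<comment> \<open>The joint distribution function at n equal thresholds is the diagonal section
      at w(n), that is D(n) at \<open>w n powr r n\<close>; the outer exponent 1/r(n) undoes the
      power.\<close>
    define w where "w n = F (c (nat \<lceil>r n\<rceil>) * x + d (nat \<lceil>r n\<rceil>))" for n
    have w_lim: "(\<lambda>n. w n powr r n) \<longlonglongrightarrow> H x"
      unfolding w_def
      by (rule tendsto_power_imp_tendsto_powr_ceiling[OF H_lim _ r_lim]) (rule F_range)
    have "w n powr r n \<in> {0..1}" if "n \<ge> 1" for n
      using r_pos[OF that] F_range by (simp add: w_def powr_le1)
    then have w_range: "\<forall>\<^sub>F n in sequentially. w n powr r n \<in> {0..1}"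
      using eventually_ge_at_top[of 1] by (rule eventually_mono[rotated])
    have "(\<lambda>n. D n (w n powr r n)) \<longlonglongrightarrow> L (H x)"
      by (rule tendsto_mono_on_diagonal[OF D_mono' D_lim L_cont w_range w_lim H_range])
    moreover have "\<forall>\<^sub>F n in sequentially. D n (w n powr r n) = cdf (distr M borel
        (\<lambda>\<omega>. (Max ((\<lambda>i. X i \<omega>) ` {..<n}) - d (nat \<lceil>r n\<rceil>)) / c (nat \<lceil>r n\<rceil>))) x"
      using eventually_ge_at_top[of 2]
    proof eventually_elim
      case (elim n)
      have "0 \<le> w n" by (simp add: w_def F_range)
      have "0 < r n" using r_pos elim by simp
      \<comment> \<open>The scalings are known to be positive only at indices from 1 on.\<close>
      then have "1 \<le> nat \<lceil>r n\<rceil>" by linarith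
      with elim show ?case
        using \<open>0 < r n\<close> \<open>0 \<le> w n\<close>
        by (simp add: cdf_normalized_Max X c joint D_def diagonal_power_distortion_def diagonal_def
            powr_powr map_replicate_const flip: w_def)
    qed
    ultimately show "(\<lambda>n. cdf (distr M borel
        (\<lambda>\<omega>. (Max ((\<lambda>i. X i \<omega>) ` {..<n}) - d (nat \<lceil>r n\<rceil>)) / c (nat \<lceil>r n\<rceil>))) x)
      \<longlonglongrightarrow> (L \<circ> GEV \<xi> \<mu> \<sigma>) x"
      by (simp add: tendsto_cong H_def)
  qed
  with D_eq D_lim show ?thesis unfolding D_def L_def by blast
qed

end
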